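(* Let $(V,\alpha,\beta,\odot_V,\varepsilon,i,V_0)$ be a generalized vector groupoid over a field $K$, let $X$ be a vector space over $K$, and let $h:X\to V_0$ be a $K$-linear map. Let $$h^*(V)=\{(x,y,a)\in X\times X\times V \mid h(x)=\alpha(a),\ h(y)=\beta(a)\},$$ with its canonical vector space structure (as a linear subspace of $X\times X\times V$). Define $\alpha^*,\beta^*:h^*(V)\to X$, $i^*:h^*(V)\to h^*(V)$ and $\varepsilon^*:X\to h^*(V)$ by $$\alpha^*(x,y,a)=x,\quad \beta^*(x,y,a)=y,\quad i^*(x,y,a)=(y,x,i(a)),\quad \varepsilon^*(x)=(x,x,\varepsilon(h(x))),$$ and define the partial multiplication $\odot_{h^*(V)}$ on $h^*(V)_{(2)}=\{((x,y,a),(y',z,b))\in h^*(V)\times h^*(V)\mid y=y',\ (a,b)\in V_{(2)}\}$ by $$(x,y,a)\odot_{h^*(V)}(y,z,b)=(x,z,a\odot_V b).$$ Then $(h^*(V),\alpha^*,\beta^*,\odot_{h^*(V)},\varepsilon^*,i^*,X)$ is a generalized vector groupoid over $K$.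
   Context: Ehresmann groupoid: a groupoid $(G,\alpha,\beta,m,\varepsilon,i,G_0)$ consists of sets $G,G_0$, surjective maps $\alpha,\beta:G\to G_0$ (source, target), a partial multiplication $m:G_{(2)}\to G$, $(x,y)\mapsto x\cdot y$, where $G_{(2)}=\{(x,y)\in G\times G\mid \beta(x)=\alpha(y)\}$, an injective map $\varepsilon:G_0\to G$ (inclusion) and a map $i:G\to G$, $i(x)=x^{-1}$ (inversion), such that: (G1) $(x\cdot y)\cdot z=x\cdot(y\cdot z)$, in the sense that if one of the two products is defined, then so is the other and they are equal; (G2) for each $x\in G$: $(\varepsilon(\alpha(x)),x)\in G_{(2)}$, $(x,\varepsilon(\beta(x)))\in G_{(2)}$ and $\varepsilon(\alpha(x))\cdot x=x=x\cdot\varepsilon(\beta(x))$; (G3) for each $x\in G$: $(x^{-1},x)\in G_{(2)}$, $(x,x^{-1})\in G_{(2)}$, $x^{-1}\cdot x=\varepsilon(\beta(x))$ and $x\cdot x^{-1}=\varepsilon(\alpha(x))$. Generalized vector groupoid over a field $K$: an Ehresmann groupoid $(V,\alpha,\beta,\odot,\varepsilon,i,V_0)$ such that $V$ and $V_0$ are vector spaces over $K$; $\alpha,\beta:V\to V_0$ are linear; $\varepsilon:V_0\to V$ and $i:V\to V$ are linear, and $x+x^{-1}=\varepsilon(\alpha(x))+\varepsilon(\beta(x))$ for all $x\in V$; and the multiplication satisfies: (1) $x\odot(y+z-\varepsilon(\beta(x)))=x\odot y+x\odot z-x$ for all $x,y,z\in V$ with $\alpha(y)=\beta(x)=\alpha(z)$;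 (2) $x\odot(ky+(1-k)\varepsilon(\beta(x)))=k(x\odot y)+(1-k)x$ for all $k\in K$ and $x,y\in V$ with $\alpha(y)=\beta(x)$; (3) $(y+z-\varepsilon(\alpha(x)))\odot x=y\odot x+z\odot x-x$ for all $x,y,z\in V$ with $\alpha(x)=\beta(y)=\beta(z)$; (4) $(ky+(1-k)\varepsilon(\alpha(x)))\odot x=k(y\odot x)+(1-k)x$ for all $k\in K$ and $x,y\in V$ with $\alpha(x)=\beta(y)$. *)

theory Defs
  imports "Jordan_Normal_Form.Missing_VectorSpace"
begin

definition composable_pairs :: "'a set \<Rightarrow> ('a \<Rightarrow> 'b) \<Rightarrow> ('a \<Rightarrow> 'b) \<Rightarrow> ('a \<times> 'a) set" where
  "composable_pairs G \<alpha> \<beta> = {(x, y). x \<in> G \<and> y \<in> G \<and> \<beta> x = \<alpha> y}"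

text \<open>
  The partial multiplication is a HOL function whose values are only meaningful on
  composable pairs: no axiom says anything about its values elsewhere.  In \<open>assoc_defined\<close>,
  a product such as \<open>(x \<cdot> y) \<cdot> z\<close> counts as defined if both pairs that are multiplied
  in it are composable.
\<close>

locale ehresmann_groupoid =
  fixes G :: "'a set" and \<alpha> \<beta> :: "'a \<Rightarrow> 'b"
    and mul :: "'a \<Rightarrow> 'a \<Rightarrow> 'a"  (infixl "\<cdot>" 70)
    and \<epsilon> :: "'b \<Rightarrow> 'a" and \<iota> :: "'a \<Rightarrow> 'a" and G0 :: "'b set"
  assumes source_surj: "\<alpha> ` G = G0"
    and target_surj: "\<beta> ` G = G0"
    and mul_closed: "(x, y) \<in> composable_pairs G \<alpha> \<beta> \<Longrightarrow> x \<cdot> y \<in> G"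
    and unit_closed: "\<epsilon> \<in> G0 \<rightarrow> G"
    and unit_inj: "inj_on \<epsilon> G0"
    and inv_closed: "\<iota> \<in> G \<rightarrow> G"
    and assoc_defined: "\<lbrakk>x \<in> G; y \<in> G; z \<in> G\<rbrakk> \<Longrightarrow>
      (x, y) \<in> composable_pairs G \<alpha> \<beta> \<and> (x \<cdot> y, z) \<in> composable_pairs G \<alpha> \<beta> \<longleftrightarrow>
      (y, z) \<in> composable_pairs G \<alpha> \<beta> \<and> (x, y \<cdot> z) \<in> composable_pairs G \<alpha> \<beta>"
    and assoc: "\<lbrakk>x \<in> G; y \<in> G; z \<in> G;
        (x, y) \<in> composable_pairs G \<alpha> \<beta>; (x \<cdot> y, z) \<in> composable_pairs G \<alpha> \<beta>\<rbrakk> \<Longrightarrow>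
      (x \<cdot> y) \<cdot> z = x \<cdot> (y \<cdot> z)"
    and unit_left_composable: "x \<in> G \<Longrightarrow> (\<epsilon> (\<alpha> x), x) \<in> composable_pairs G \<alpha> \<beta>"
    and unit_right_composable: "x \<in> G \<Longrightarrow> (x, \<epsilon> (\<beta> x)) \<in> composable_pairs G \<alpha> \<beta>"
    and unit_left: "x \<in> G \<Longrightarrow> \<epsilon> (\<alpha> x) \<cdot> x = x"
    and unit_right: "x \<in> G \<Longrightarrow> x \<cdot> \<epsilon> (\<beta> x) = x"
    and inv_left_composable: "x \<in> G \<Longrightarrow> (\<iota> x, x) \<in> composable_pairs G \<alpha> \<beta>"
    and inv_right_composable: "x \<in> G \<Longrightarrow> (x, \<iota> x) \<in> composable_pairs G \<alpha> \<beta>"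
    and inv_left: "x \<in> G \<Longrightarrow> \<iota> x \<cdot> x = \<epsilon> (\<beta> x)"
    and inv_right: "x \<in> G \<Longrightarrow> x \<cdot> \<iota> x = \<epsilon> (\<alpha> x)"

text \<open>
  Here \<open>\<odot>\<^bsub>V\<^esub>\<close> is the scalar multiplication of the vector space \<open>V\<close>, while the
  groupoid multiplication is written \<open>\<cdot>\<close>.
\<close>

locale generalized_vector_groupoid =
  ehresmann_groupoid "carrier V" \<alpha> \<beta> mul \<epsilon> \<iota> "carrier V0"
  for K :: "('k, 'kx) ring_scheme" and V :: "('k, 'v, 'vx) module_scheme"
    and \<alpha> \<beta> :: "'v \<Rightarrow> 'w" and mul :: "'v \<Rightarrow> 'v \<Rightarrow> 'v"  (infixl "\<cdot>" 70)
    and \<epsilon> :: "'w \<Rightarrow> 'v" and \<iota> :: "'v \<Rightarrow> 'v" and V0 :: "('k, 'w, 'wx) module_scheme" +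
  assumes vectorspace_total: "vectorspace K V"
    and vectorspace_base: "vectorspace K V0"
    and source_linear: "linear_map K V V0 \<alpha>"
    and target_linear: "linear_map K V V0 \<beta>"
    and unit_linear: "linear_map K V0 V \<epsilon>"
    and inv_linear: "linear_map K V V \<iota>"
    and add_inv: "x \<in> carrier V \<Longrightarrow> x \<oplus>\<^bsub>V\<^esub> \<iota> x = \<epsilon> (\<alpha> x) \<oplus>\<^bsub>V\<^esub> \<epsilon> (\<beta> x)"
    and mul_add_right: "\<lbrakk>x \<in> carrier V; y \<in> carrier V; z \<in> carrier V; \<alpha> y = \<beta> x; \<beta> x = \<alpha> z\<rbrakk> \<Longrightarrow>
      x \<cdot> (y \<oplus>\<^bsub>V\<^esub> z \<ominus>\<^bsub>V\<^esub> \<epsilon> (\<beta> x)) = (x \<cdot> y) \<oplus>\<^bsub>V\<^esub> (x \<cdot> z) \<ominus>\<^bsub>V\<^esub> x"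
    and mul_smult_right: "\<lbrakk>k \<in> carrier K; x \<in> carrier V; y \<in> carrier V; \<alpha> y = \<beta> x\<rbrakk> \<Longrightarrow>
      x \<cdot> ((k \<odot>\<^bsub>V\<^esub> y) \<oplus>\<^bsub>V\<^esub> ((\<one>\<^bsub>K\<^esub> \<ominus>\<^bsub>K\<^esub> k) \<odot>\<^bsub>V\<^esub> \<epsilon> (\<beta> x))) =
      (k \<odot>\<^bsub>V\<^esub> (x \<cdot> y)) \<oplus>\<^bsub>V\<^esub> ((\<one>\<^bsub>K\<^esub> \<ominus>\<^bsub>K\<^esub> k) \<odot>\<^bsub>V\<^esub> x)"
    and mul_add_left: "\<lbrakk>x \<in> carrier V; y \<in> carrier V; z \<in> carrier V; \<alpha> x = \<beta> y; \<beta> y = \<beta> z\<rbrakk> \<Longrightarrow>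
      (y \<oplus>\<^bsub>V\<^esub> z \<ominus>\<^bsub>V\<^esub> \<epsilon> (\<alpha> x)) \<cdot> x = (y \<cdot> x) \<oplus>\<^bsub>V\<^esub> (z \<cdot> x) \<ominus>\<^bsub>V\<^esub> x"
    and mul_smult_left: "\<lbrakk>k \<in> carrier K; x \<in> carrier V; y \<in> carrier V; \<alpha> x = \<beta> y\<rbrakk> \<Longrightarrow>
      ((k \<odot>\<^bsub>V\<^esub> y) \<oplus>\<^bsub>V\<^esub> ((\<one>\<^bsub>K\<^esub> \<ominus>\<^bsub>K\<^esub> k) \<odot>\<^bsub>V\<^esub> \<epsilon> (\<alpha> x))) \<cdot> x =
      (k \<odot>\<^bsub>V\<^esub> (y \<cdot> x)) \<oplus>\<^bsub>V\<^esub> ((\<one>\<^bsub>K\<^esub> \<ominus>\<^bsub>K\<^esub> k) \<odot>\<^bsub>V\<^esub> x)"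

text \<open>
  The vector space \<open>h\<^sup>*(V)\<close>, with the operations of \<open>X \<times> X \<times> V\<close> restricted to the given carrier.
\<close>

definition pullback_space ::
  "('k, 'x, 'xx) module_scheme \<Rightarrow> ('k, 'v, 'vx) module_scheme \<Rightarrow> ('v \<Rightarrow> 'w) \<Rightarrow> ('v \<Rightarrow> 'w) \<Rightarrow>
   ('x \<Rightarrow> 'w) \<Rightarrow> ('k, 'x \<times> 'x \<times> 'v) module" where
  "pullback_space X V \<alpha> \<beta> h =
     (direct_sum X (direct_sum X V))
       \<lparr>carrier := {(x, y, a). x \<in> carrier X \<and> y \<in> carrier X \<and> a \<in> carrier V \<and>
                               h x = \<alpha> a \<and> h y = \<beta> a}\<rparr>"

end

theory Submission
  imports Defs
begin

section \<open>Linear maps and two cancellation identities in modules\<close>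

lemma linear_mapI:
  assumes "vectorspace K V" "vectorspace K W" "T \<in> carrier V \<rightarrow> carrier W"
    and "\<And>u v. u \<in> carrier V \<Longrightarrow> v \<in> carrier V \<Longrightarrow> T (u \<oplus>\<^bsub>V\<^esub> v) = T u \<oplus>\<^bsub>W\<^esub> T v"
    and "\<And>k v. k \<in> carrier K \<Longrightarrow> v \<in> carrier V \<Longrightarrow> T (k \<odot>\<^bsub>V\<^esub> v) = k \<odot>\<^bsub>W\<^esub> T v"
  shows "linear_map K V W T"
  using assms
  by (auto simp: linear_map_def mod_hom_def mod_hom_axioms_def module_hom_def vectorspace_def)

lemma linear_mapD:
  assumes "linear_map K V W T"
  shows linear_map_closed: "v \<in> carrier V \<Longrightarrow> T v \<in> carrier W"
    and linear_map_add:
      "u \<in> carrier V \<Longrightarrow> v \<in> carrier V \<Longrightarrow> T (u \<oplus>\<^bsub>V\<^esub> v) = T u \<oplus>\<^bsub>W\<^esub> T v"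
    and linear_map_smult:
      "k \<in> carrier K \<Longrightarrow> v \<in> carrier V \<Longrightarrow> T (k \<odot>\<^bsub>V\<^esub> v) = k \<odot>\<^bsub>W\<^esub> T v"
    and linear_map_zero: "T \<zero>\<^bsub>V\<^esub> = \<zero>\<^bsub>W\<^esub>"
proof -
  interpret mod_hom K V W T
    using assms by (simp add: linear_map_def)
  show "v \<in> carrier V \<Longrightarrow> T v \<in> carrier W"
    "u \<in> carrier V \<Longrightarrow> v \<in> carrier V \<Longrightarrow> T (u \<oplus>\<^bsub>V\<^esub> v) = T u \<oplus>\<^bsub>W\<^esub> T v"
    "k \<in> carrier K \<Longrightarrow> v \<in> carrier V \<Longrightarrow> T (k \<odot>\<^bsub>V\<^esub> v) = k \<odot>\<^bsub>W\<^esub> T v"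
    "T \<zero>\<^bsub>V\<^esub> = \<zero>\<^bsub>W\<^esub>"
    using f_hom by (auto simp: module_hom_def)
qed

lemma (in abelian_group) add_diff_self:
  "x \<in> carrier G \<Longrightarrow> y \<in> carrier G \<Longrightarrow> (x \<oplus> y) \<ominus> y = x"
  by (simp add: a_minus_def a_assoc r_neg)

text \<open>The coefficients \<open>k\<close> and \<open>\<one> \<ominus> k\<close> sum to
  \<open>\<one>\<close>, so an affine combination of \<open>x\<close> with itself collapses by
  distributivity.\<close>

lemma (in module) smult_affine_self:
  assumes "k \<in> carrier R" "x \<in> carrier M"
  shows "k \<odot>\<^bsub>M\<^esub> x \<oplus>\<^bsub>M\<^esub> (\<one> \<ominus> k) \<odot>\<^bsub>M\<^esub> x = x"
proof -
  have "k \<oplus> (\<one> \<ominus> k) = \<one>"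
    using assms by (simp add: a_minus_def R.a_lcomm[of k \<one>] R.r_neg)
  with assms show ?thesis
    by (simp flip: smult_l_distr)
qed

section \<open>Sources and targets of units, inverses and products\<close>

context ehresmann_groupoid
begin

lemma source_closed: "x \<in> G \<Longrightarrow> \<alpha> x \<in> G0"
  and target_closed: "x \<in> G \<Longrightarrow> \<beta> x \<in> G0"
  using source_surj target_surj by auto

text \<open>Surjectivity of \<open>\<alpha>\<close> writes \<open>u\<close> as
  \<open>\<alpha> x\<close>; composability of \<open>\<epsilon> (\<alpha> x)\<close> with
  \<open>x\<close> is then the claim. The next lemma argues dually through
  \<open>\<beta>\<close>.\<close>

lemma target_unit: "u \<in> G0 \<Longrightarrow> \<beta> (\<epsilon> u) = u"
  using unit_left_composable source_surj by (auto simp: composable_pairs_def)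

lemma source_unit: "u \<in> G0 \<Longrightarrow> \<alpha> (\<epsilon> u) = u"
  using unit_right_composable target_surj by (fastforce simp: composable_pairs_def)

lemma source_inv: "x \<in> G \<Longrightarrow> \<alpha> (\<iota> x) = \<beta> x"
  using inv_right_composable by (auto simp: composable_pairs_def)

lemma target_inv: "x \<in> G \<Longrightarrow> \<beta> (\<iota> x) = \<alpha> x"
  using inv_left_composable by (auto simp: composable_pairs_def)

lemma mul_in: "\<lbrakk>x \<in> G; y \<in> G; \<beta> x = \<alpha> y\<rbrakk> \<Longrightarrow> x \<cdot> y \<in> G"
  using mul_closed by (auto simp: composable_pairs_def)

text \<open>
  Since \<open>\<epsilon> (\<alpha> x) \<cdot> x = x\<close>, the product \<open>(\<epsilon> (\<alpha> x) \<cdot> x) \<cdot> y\<close> is defined, hence so is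
  \<open>\<epsilon> (\<alpha> x) \<cdot> (x \<cdot> y)\<close>, which forces \<open>\<alpha> (x \<cdot> y) = \<alpha> x\<close>.
\<close>

lemma source_mul:
  assumes "x \<in> G" "y \<in> G" "\<beta> x = \<alpha> y"
  shows "\<alpha> (x \<cdot> y) = \<alpha> x"
proof -
  have "\<epsilon> (\<alpha> x) \<in> G"
    using unit_left_composable[OF assms(1)] by (auto simp: composable_pairs_def)
  then show ?thesis
    using assoc_defined[of "\<epsilon> (\<alpha> x)" x y] assms unit_left_composable[of x] unit_left[of x]
    by (auto simp: composable_pairs_def)
qed

text \<open>Dual argument: \<open>y \<cdot> \<epsilon> (\<beta> y) = y\<close> makes the right
  bracketing of \<open>x\<close>, \<open>y\<close>, \<open>\<epsilon> (\<beta> y)\<close> defined,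
  hence also the left one, and both \<open>x \<cdot> y\<close> and \<open>y\<close> are composable
  with the same unit.\<close>

lemma target_mul:
  assumes "x \<in> G" "y \<in> G" "\<beta> x = \<alpha> y"
  shows "\<beta> (x \<cdot> y) = \<beta> y"
proof -
  have "\<epsilon> (\<beta> y) \<in> G"
    using unit_right_composable[OF assms(2)] by (auto simp: composable_pairs_def)
  then show ?thesis
    using assoc_defined[of x y "\<epsilon> (\<beta> y)"] assms unit_right_composable[of y] unit_right[of y]
    by (auto simp: composable_pairs_def)
qed

text \<open>Associativity with conditions on adjacent factors only: \<open>target_mul\<close>
  supplies the composability of \<open>x \<cdot> y\<close> with \<open>z\<close>.\<close>

lemma mul_assoc: "\<lbrakk>x \<in> G; y \<in> G; z \<in> G; \<beta> x = \<alpha> y; \<beta> y = \<alpha> z\<rbrakk> \<Longrightarrow> (x \<cdot> y) \<cdot> z = x \<cdot> (y \<cdot> z)"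
  using assoc by (simp add: composable_pairs_def mul_in target_mul)

end

section \<open>The pullback as a vector space\<close>

locale vector_groupoid_pullback = generalized_vector_groupoid K V \<alpha> \<beta> mul \<epsilon> \<iota> V0
  for K :: "('k, 'kx) ring_scheme" and V :: "('k, 'v, 'vx) module_scheme"
    and \<alpha> \<beta> :: "'v \<Rightarrow> 'w" and mul :: "'v \<Rightarrow> 'v \<Rightarrow> 'v"  (infixl "\<cdot>" 70)
    and \<epsilon> :: "'w \<Rightarrow> 'v" and \<iota> :: "'v \<Rightarrow> 'v" and V0 :: "('k, 'w, 'wx) module_scheme" +
  fixes X :: "('k, 'x, 'xx) module_scheme" and h :: "'x \<Rightarrow> 'w"
  assumes vectorspace_X: "vectorspace K X" and h_linear: "linear_map K X V0 h"
begin

abbreviation P where "P \<equiv> pullback_space X V \<alpha> \<beta> h"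

sublocale V: vectorspace K V by (fact vectorspace_total)
sublocale V0: vectorspace K V0 by (fact vectorspace_base)
sublocale X: vectorspace K X by (fact vectorspace_X)

lemmas h_simps = linear_mapD[OF h_linear]
lemmas source_simps = linear_mapD[OF source_linear]
lemmas target_simps = linear_mapD[OF target_linear]
lemmas unit_simps = linear_mapD[OF unit_linear]
lemmas inv_simps = linear_mapD[OF inv_linear]
lemmas structure_simps = h_simps source_simps target_simps unit_simps inv_simps
  source_unit target_unit source_inv target_inv source_mul target_mul mul_in

lemma carrier_P: "(x, y, a) \<in> carrier P \<longleftrightarrow>
    x \<in> carrier X \<and> y \<in> carrier X \<and> a \<in> carrier V \<and> h x = \<alpha> a \<and> h y = \<beta> a"
  by (simp add: pullback_space_def)

lemma add_P: "(x, y, a) \<oplus>\<^bsub>P\<^esub> (x', y', a') = (x \<oplus>\<^bsub>X\<^esub> x', y \<oplus>\<^bsub>X\<^esub> y', a \<oplus>\<^bsub>V\<^esub> a')"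
  by (simp add: pullback_space_def direct_sum_def)

lemma smult_P: "k \<odot>\<^bsub>P\<^esub> (x, y, a) = (k \<odot>\<^bsub>X\<^esub> x, k \<odot>\<^bsub>X\<^esub> y, k \<odot>\<^bsub>V\<^esub> a)"
  by (simp add: pullback_space_def direct_sum_def)

lemma zero_P: "\<zero>\<^bsub>P\<^esub> = (\<zero>\<^bsub>X\<^esub>, \<zero>\<^bsub>X\<^esub>, \<zero>\<^bsub>V\<^esub>)"
  by (simp add: pullback_space_def direct_sum_def)

lemma vectorspace_P: "vectorspace K P"
proof -
  let ?D = "direct_sum X (direct_sum X V)"
  let ?H = "{(x, y, a). x \<in> carrier X \<and> y \<in> carrier X \<and> a \<in> carrier V \<and> h x = \<alpha> a \<and> h y = \<beta> a}"
  have D: "vectorspace K ?D"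
    by (intro direct_sum_is_vs X.vectorspace_axioms V.vectorspace_axioms)
  then have "module K ?D" by (simp add: vectorspace_def)
  \<comment> \<open>The conditions cutting out \<open>?H\<close> are preserved by zero, sums and
    scalars because \<open>h\<close>, \<open>\<alpha>\<close> and \<open>\<beta>\<close> are
    linear.\<close>
  then have "LinearCombinations.submodule K ?H ?D"
    by (unfold LinearCombinations.submodule_def) (auto simp: direct_sum_def structure_simps)
  with D show ?thesis
    unfolding pullback_space_def by (auto intro: vectorspace.subspace_is_vs simp: subspace_def)
qed

sublocale P: vectorspace K P by (fact vectorspace_P)

text \<open>Negation depends on the carrier, so unfolding \<open>P\<close> does not compute it as it
  does addition. Instead, the components of a left inverse in \<open>P\<close> are left inverses in
  the factors, and these are unique.\<close>

lemma minus_P: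
  assumes "(x, y, a) \<in> carrier P" "(x', y', a') \<in> carrier P"
  shows "(x, y, a) \<ominus>\<^bsub>P\<^esub> (x', y', a') = (x \<ominus>\<^bsub>X\<^esub> x', y \<ominus>\<^bsub>X\<^esub> y', a \<ominus>\<^bsub>V\<^esub> a')"
proof -
  obtain u v c where n: "\<ominus>\<^bsub>P\<^esub> (x', y', a') = (u, v, c)"
    by (cases "\<ominus>\<^bsub>P\<^esub> (x', y', a')")
  have "(u, v, c) \<in> carrier P" "(u, v, c) \<oplus>\<^bsub>P\<^esub> (x', y', a') = \<zero>\<^bsub>P\<^esub>"
    using P.M.a_inv_closed[OF assms(2)] P.M.l_neg[OF assms(2)] by (simp_all add: n)
  with assms have "u = \<ominus>\<^bsub>X\<^esub> x'" "v = \<ominus>\<^bsub>X\<^esub> y'" "c = \<ominus>\<^bsub>V\<^esub> a'"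
    by (auto simp: add_P zero_P carrier_P X.M.minus_equality V.M.minus_equality)
  then show ?thesis
    by (simp add: a_minus_def n add_P)
qed

section \<open>The groupoid structure on the pullback and its compatibility with the linear
  structure\<close>

abbreviation "source_P \<equiv> \<lambda>(x :: 'x, y :: 'x, a :: 'v). x"
abbreviation "target_P \<equiv> \<lambda>(x :: 'x, y :: 'x, a :: 'v). y"
abbreviation "mul_P \<equiv> \<lambda>(x :: 'x, y :: 'x, a) (y' :: 'x, z :: 'x, b). (x, z, a \<cdot> b)"
abbreviation "unit_P \<equiv> \<lambda>x. (x, x, \<epsilon> (h x))"
abbreviation "inv_P \<equiv> \<lambda>(x :: 'x, y :: 'x, a). (y, x, \<iota> a)"

lemma add_minus_P:
  assumes "(x, y, a) \<in> carrier P" "(x', y', a') \<in> carrier P" "(x'', y'', a'') \<in> carrier P"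
  shows "(x, y, a) \<oplus>\<^bsub>P\<^esub> (x', y', a') \<ominus>\<^bsub>P\<^esub> (x'', y'', a'') =
    (x \<oplus>\<^bsub>X\<^esub> x' \<ominus>\<^bsub>X\<^esub> x'', y \<oplus>\<^bsub>X\<^esub> y' \<ominus>\<^bsub>X\<^esub> y'', a \<oplus>\<^bsub>V\<^esub> a' \<ominus>\<^bsub>V\<^esub> a'')"
  using P.M.a_closed[OF assms(1,2)] assms(3) by (simp add: add_P minus_P)

lemma unit_P_closed: "x \<in> carrier X \<Longrightarrow> unit_P x \<in> carrier P"
  by (simp add: carrier_P structure_simps)

text \<open>The shared \<open>y\<close> forces \<open>\<beta> a = h y = \<alpha> b\<close>, so
  \<open>a \<cdot> b\<close> is a genuine product; it keeps the source of \<open>a\<close> and the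
  target of \<open>b\<close>, which are the values at \<open>x\<close> and \<open>z\<close>.\<close>

lemma mul_P_closed:
  "(x, y, a) \<in> carrier P \<Longrightarrow> (y, z, b) \<in> carrier P \<Longrightarrow> (x, z, a \<cdot> b) \<in> carrier P"
  by (simp add: carrier_P structure_simps)

lemma composable_P: "(p, q) \<in> composable_pairs (carrier P) source_P target_P \<longleftrightarrow>
    (\<exists>x y a z b. p = (x, y, a) \<and> q = (y, z, b) \<and> (x, y, a) \<in> carrier P \<and> (y, z, b) \<in> carrier P)"
  by (cases p; cases q) (auto simp: composable_pairs_def)

text \<open>On the first two components the operations are those of the pair groupoid of
  \<open>X\<close>; on the third, each axiom is the one in \<open>V\<close>.\<close>

lemma ehresmann_groupoid_P:
  "ehresmann_groupoid (carrier P) source_P target_P mul_P unit_P inv_P (carrier X)"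
proof
  \<comment> \<open>The unit at \<open>x\<close> is a preimage of \<open>x\<close> under both
    maps.\<close>
  have "x \<in> source_P ` carrier P" "x \<in> target_P ` carrier P" if "x \<in> carrier X" for x
    using imageI[OF unit_P_closed[OF that], of source_P]
      imageI[OF unit_P_closed[OF that], of target_P] by simp_all
  then show "source_P ` carrier P = carrier X" "target_P ` carrier P = carrier X"
    by (auto simp: carrier_P)
  show "unit_P \<in> carrier X \<rightarrow> carrier P"
    using unit_P_closed by auto
  show "inj_on unit_P (carrier X)"
    by (rule inj_onI) simp
  show "inv_P \<in> carrier P \<rightarrow> carrier P"
    by (auto simp: carrier_P structure_simps)
next
  fix p q assume "(p, q) \<in> composable_pairs (carrier P) source_P target_P"
  then show "mul_P p q \<in> carrier P"
    by (auto simp: composable_P mul_P_closed)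
next
  fix p q r assume "p \<in> carrier P" "q \<in> carrier P" "r \<in> carrier P"
  then show "(p, q) \<in> composable_pairs (carrier P) source_P target_P \<and>
      (mul_P p q, r) \<in> composable_pairs (carrier P) source_P target_P \<longleftrightarrow>
      (q, r) \<in> composable_pairs (carrier P) source_P target_P \<and>
      (p, mul_P q r) \<in> composable_pairs (carrier P) source_P target_P"
    by (cases p; cases q; cases r) (auto simp: composable_P mul_P_closed)
next
  fix p q r assume "p \<in> carrier P" "q \<in> carrier P" "r \<in> carrier P"
    "(p, q) \<in> composable_pairs (carrier P) source_P target_P"
    "(mul_P p q, r) \<in> composable_pairs (carrier P) source_P target_P"
  then show "mul_P (mul_P p q) r = mul_P p (mul_P q r)"
    by (cases p; cases q; cases r) (auto simp: composable_P carrier_P mul_assoc)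
next
  fix p assume "p \<in> carrier P"
  moreover obtain x y a where "p = (x, y, a)"
    by (cases p)
  \<comment> \<open>Membership of the ends in \<open>V0\<close> makes the unit rules applicable to
    \<open>\<alpha> a\<close> and \<open>\<beta> a\<close>.\<close>
  ultimately have p: "p = (x, y, a)" "x \<in> carrier X" "y \<in> carrier X" "a \<in> carrier V"
      "h x = \<alpha> a" "h y = \<beta> a" "\<alpha> a \<in> carrier V0" "\<beta> a \<in> carrier V0"
    using source_closed target_closed by (auto simp: carrier_P)
  show "(unit_P (source_P p), p) \<in> composable_pairs (carrier P) source_P target_P"
    "(p, unit_P (target_P p)) \<in> composable_pairs (carrier P) source_P target_P"
    "(inv_P p, p) \<in> composable_pairs (carrier P) source_P target_P"
    "(p, inv_P p) \<in> composable_pairs (carrier P) source_P target_P"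
    "mul_P (unit_P (source_P p)) p = p" "mul_P p (unit_P (target_P p)) = p"
    "mul_P (inv_P p) p = unit_P (target_P p)" "mul_P p (inv_P p) = unit_P (source_P p)"
    using p by (simp_all add: composable_P carrier_P source_unit target_unit source_inv target_inv
        unit_simps(1) inv_simps(1) unit_left unit_right inv_left inv_right)
qed

text \<open>
  In each distributivity law the \<open>X\<close>-component contributed by the outer end \<open>u\<close> of the fixed
  factor reduces to \<open>(u + u) - u = u\<close> or \<open>k u + (1 - k) u = u\<close>; the other \<open>X\<close>-component agrees on
  both sides, and the \<open>V\<close>-component is the law in \<open>V\<close>.
\<close>

lemma generalized_vector_groupoid_P:
  "generalized_vector_groupoid K P source_P target_P mul_P unit_P inv_P X"
proof (intro generalized_vector_groupoid.intro ehresmann_groupoid_P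
    generalized_vector_groupoid_axioms.intro vectorspace_P vectorspace_X)
  show "linear_map K P X source_P" "linear_map K P X target_P"
    by (rule linear_mapI[OF vectorspace_P vectorspace_X]; auto simp: carrier_P add_P smult_P)+
  show "linear_map K X P unit_P"
    by (rule linear_mapI[OF vectorspace_X vectorspace_P])
      (auto simp: unit_P_closed add_P smult_P h_simps unit_simps)
  show "linear_map K P P inv_P"
    by (rule linear_mapI[OF vectorspace_P vectorspace_P])
      (auto simp: carrier_P add_P smult_P inv_simps source_inv target_inv)
next
  fix p assume "p \<in> carrier P"
  then show "p \<oplus>\<^bsub>P\<^esub> inv_P p = unit_P (source_P p) \<oplus>\<^bsub>P\<^esub> unit_P (target_P p)"
    \<comment> \<open>The \<open>X\<close>-components on the left are \<open>x + y\<close> and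
      \<open>y + x\<close>, while both are \<open>x + y\<close> on the right; hence commutativity
      besides \<open>add_inv\<close>.\<close>
    by (cases p) (auto simp: carrier_P add_P add_inv X.M.a_comm)
next
  fix p q r assume asm: "p \<in> carrier P" "q \<in> carrier P" "r \<in> carrier P"
    "source_P q = target_P p" "target_P p = source_P r"
  obtain x y a where p: "p = (x, y, a)" by (cases p)
  obtain y' z b where q: "q = (y', z, b)" by (cases q)
  obtain y'' w c where r: "r = (y'', w, c)" by (cases r)
  have pqr: "p = (x, y, a)" "q = (y, z, b)" "r = (y, w, c)"
    and mem: "(x, y, a) \<in> carrier P" "(y, z, b) \<in> carrier P" "(y, w, c) \<in> carrier P"
    using asm by (simp_all add: p q r)
  \<comment> \<open>Rewriting \<open>h y\<close> to \<open>\<beta> a\<close> turns the third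
    component of the unit at \<open>y\<close> into the unit subtracted in
    \<open>mul_add_right\<close>.\<close>
  have [simp]: "y \<in> carrier X" "x \<in> carrier X" "a \<in> carrier V" "b \<in> carrier V" "c \<in> carrier V"
    "h y = \<beta> a" "\<alpha> b = \<beta> a" "\<alpha> c = \<beta> a"
    using mem by (auto simp: carrier_P)
  show "mul_P p (q \<oplus>\<^bsub>P\<^esub> r \<ominus>\<^bsub>P\<^esub> unit_P (target_P p)) = mul_P p q \<oplus>\<^bsub>P\<^esub> mul_P p r \<ominus>\<^bsub>P\<^esub> p"
    \<comment> \<open>Componentwise subtraction is available only inside \<open>P\<close>, hence the
      memberships of the products and of the unit.\<close>
    unfolding pqr using mem mul_P_closed[OF mem(1,2)] mul_P_closed[OF mem(1,3)]
      unit_P_closed[of y]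
    by (simp add: add_minus_P mul_add_right X.M.add_diff_self)
next
  fix k p q assume k: "k \<in> carrier K" and asm: "p \<in> carrier P" "q \<in> carrier P" "source_P q = target_P p"
  obtain x y a where p: "p = (x, y, a)" by (cases p)
  obtain y' z b where q: "q = (y', z, b)" by (cases q)
  have pq: "p = (x, y, a)" "q = (y, z, b)" and mem: "(x, y, a) \<in> carrier P" "(y, z, b) \<in> carrier P"
    using asm by (simp_all add: p q)
  show "mul_P p (k \<odot>\<^bsub>P\<^esub> q \<oplus>\<^bsub>P\<^esub> (\<one>\<^bsub>K\<^esub> \<ominus>\<^bsub>K\<^esub> k) \<odot>\<^bsub>P\<^esub> unit_P (target_P p)) =
      k \<odot>\<^bsub>P\<^esub> mul_P p q \<oplus>\<^bsub>P\<^esub> (\<one>\<^bsub>K\<^esub> \<ominus>\<^bsub>K\<^esub> k) \<odot>\<^bsub>P\<^esub> p"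
    \<comment> \<open>No subtraction in \<open>P\<close> occurs here, so the law splits into
      components directly; \<open>smult_affine_self\<close> settles the end
      \<open>x\<close>.\<close>
    using k mem mul_smult_right[of k a b]
    by (simp add: pq add_P smult_P carrier_P X.smult_affine_self)
next
  fix p q r assume asm: "p \<in> carrier P" "q \<in> carrier P" "r \<in> carrier P"
    "source_P p = target_P q" "target_P q = target_P r"
  obtain x y a where p: "p = (x, y, a)" by (cases p)
  obtain z x' b where q: "q = (z, x', b)" by (cases q)
  obtain w x'' c where r: "r = (w, x'', c)" by (cases r)
  \<comment> \<open>With \<open>p\<close> now on the right, the shared end is its source
    \<open>x\<close>, and its target \<open>y\<close> is the component to be cancelled.\<close>
  have pqr: "p = (x, y, a)" "q = (z, x, b)" "r = (w, x, c)"
    and mem: "(x, y, a) \<in> carrier P" "(z, x, b) \<in> carrier P" "(w, x, c) \<in> carrier P"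
    using asm by (simp_all add: p q r)
  have [simp]: "y \<in> carrier X" "x \<in> carrier X" "a \<in> carrier V" "b \<in> carrier V" "c \<in> carrier V"
    "h x = \<alpha> a" "\<beta> b = \<alpha> a" "\<beta> c = \<alpha> a"
    using mem by (auto simp: carrier_P)
  show "mul_P (q \<oplus>\<^bsub>P\<^esub> r \<ominus>\<^bsub>P\<^esub> unit_P (source_P p)) p = mul_P q p \<oplus>\<^bsub>P\<^esub> mul_P r p \<ominus>\<^bsub>P\<^esub> p"
    unfolding pqr using mem mul_P_closed[OF mem(2,1)] mul_P_closed[OF mem(3,1)]
      unit_P_closed[of x]
    by (simp add: add_minus_P mul_add_left X.M.add_diff_self)
next
  fix k p q assume k: "k \<in> carrier K" and asm: "p \<in> carrier P" "q \<in> carrier P" "source_P p = target_P q"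
  obtain x y a where p: "p = (x, y, a)" by (cases p)
  obtain z x' b where q: "q = (z, x', b)" by (cases q)
  have pq: "p = (x, y, a)" "q = (z, x, b)" and mem: "(x, y, a) \<in> carrier P" "(z, x, b) \<in> carrier P"
    using asm by (simp_all add: p q)
  show "mul_P (k \<odot>\<^bsub>P\<^esub> q \<oplus>\<^bsub>P\<^esub> (\<one>\<^bsub>K\<^esub> \<ominus>\<^bsub>K\<^esub> k) \<odot>\<^bsub>P\<^esub> unit_P (source_P p)) p =
      k \<odot>\<^bsub>P\<^esub> mul_P q p \<oplus>\<^bsub>P\<^esub> (\<one>\<^bsub>K\<^esub> \<ominus>\<^bsub>K\<^esub> k) \<odot>\<^bsub>P\<^esub> p"
    using k mem mul_smult_left[of k a b]
    by (simp add: pq add_P smult_P carrier_P X.smult_affine_self)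
qed

end

theorem proposition4p1:
  fixes K :: "('k, 'kx) ring_scheme"
    and V :: "('k, 'v, 'vx) module_scheme"
    and V0 :: "('k, 'w, 'wx) module_scheme"
    and X :: "('k, 'x, 'xx) module_scheme"
    and \<alpha> \<beta> :: "'v \<Rightarrow> 'w" and mul :: "'v \<Rightarrow> 'v \<Rightarrow> 'v"
    and \<epsilon> :: "'w \<Rightarrow> 'v" and \<iota> :: "'v \<Rightarrow> 'v" and h :: "'x \<Rightarrow> 'w"
  assumes "generalized_vector_groupoid K V \<alpha> \<beta> mul \<epsilon> \<iota> V0"
    and "vectorspace K X"
    and "linear_map K X V0 h"
  shows "composable_pairs (carrier (pullback_space X V \<alpha> \<beta> h)) (\<lambda>(x, y, a). x) (\<lambda>(x, y, a). y) =
      {((x, y, a), (y', z, b)) | x y a y' z b.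
        (x, y, a) \<in> carrier (pullback_space X V \<alpha> \<beta> h) \<and>
        (y', z, b) \<in> carrier (pullback_space X V \<alpha> \<beta> h) \<and>
        y = y' \<and> (a, b) \<in> composable_pairs (carrier V) \<alpha> \<beta>} \<and>
    generalized_vector_groupoid K (pullback_space X V \<alpha> \<beta> h)
      (\<lambda>(x, y, a). x)
      (\<lambda>(x, y, a). y)
      (\<lambda>(x, y, a) (y', z, b). (x, z, mul a b))
      (\<lambda>x. (x, x, \<epsilon> (h x)))
      (\<lambda>(x, y, a). (y, x, \<iota> a))
      X"
proof -
  interpret vector_groupoid_pullback K V \<alpha> \<beta> mul \<epsilon> \<iota> V0 X h
    using assms by (simp add: vector_groupoid_pullback_def vector_groupoid_pullback_axioms_def)
  show ?thesis
    \<comment> \<open>For the set equality, composability of \<open>a\<close> and \<open>b\<close>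
      in \<open>V\<close> follows from membership and \<open>y = y'\<close>, since both inner ends
      equal \<open>h y\<close>.\<close>
    using generalized_vector_groupoid_P by (auto simp: composable_pairs_def carrier_P)
qed

end
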